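(* Let $m\in\mathbb Z\setminus\{0\}$, $h\ge1$ an integer, and $\xi,\xi'\in\mathbb Z_m$ with $d:=\gcd(m,\xi)=\gcd(m,\xi')$; put $\hat m=m/d$. Then: (1) if $\overline{BS}(m,\xi)$ and $\overline{BS}(m,\xi')$ have the same relations up to length $2(|m|+1)h+2|m|+6$, then $\xi\equiv\xi'\pmod{\hat m^hd\,\mathbb Z_m}$; (2) if $\xi\equiv\xi'\pmod{\hat m^hd\,\mathbb Z_m}$, then $\overline{BS}(m,\xi)$ and $\overline{BS}(m,\xi')$ have the same relations up to length $2h$.
   Context: $\mathbb Z_m$ is the ring of $m$-adic integers; $\gcd(m,\xi)$ is the positive integer $d$ with $m\mathbb Z_m+\xi\mathbb Z_m=d\mathbb Z_m$. For $p,q\in\mathbb Z\setminus\{0\}$, $BS(p,q)=\langle a,b\mid ab^pa^{-1}=b^q\rangle$, marked by $(a,b)$. $\mathcal G_2$ is the space of normal subgroups of $\mathbb F(a,b)$ with the ultrametric $d(N_1,N_2)=e^{-\lambda}$, $\lambda$ the minimal word length of an element of $N_1\triangle N_2$. $\overline{BS}(m,\xi)$ is the limit in $\mathcal G_2$ of $BS(m,\xi_n)$ for any sequence of integers $(\xi_n)$ with $|\xi_n|\to\infty$, $\xi_n\to\xi$ in $\mathbb Z_m$ (exists, independent of the sequence). Two marked groups on $(a,b)$ have the same relations up to length $L$ if every reduced word $w\in\mathbb F(a,b)$ with $|w|\le L$ is trivial in one group iff it is trivial in the other. *)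

theory Defs
  imports Main
begin

text \<open>Z_m is the inverse limit of Z/|m|^k Z; an element is a compatible sequence of
residues x k in [0, |m|^k).\<close>

definition Zm :: "int \<Rightarrow> (nat \<Rightarrow> int) set" where
  "Zm m = {x. \<forall>k. 0 \<le> x k \<and> x k < \<bar>m\<bar> ^ k \<and> x (Suc k) mod \<bar>m\<bar> ^ k = x k}"

definition zm_of_int :: "int \<Rightarrow> int \<Rightarrow> (nat \<Rightarrow> int)" where
  "zm_of_int m c = (\<lambda>k. c mod \<bar>m\<bar> ^ k)"

definition zm_add :: "int \<Rightarrow> (nat \<Rightarrow> int) \<Rightarrow> (nat \<Rightarrow> int) \<Rightarrow> (nat \<Rightarrow> int)" where
  "zm_add m x y = (\<lambda>k. (x k + y k) mod \<bar>m\<bar> ^ k)"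

definition zm_mul :: "int \<Rightarrow> (nat \<Rightarrow> int) \<Rightarrow> (nat \<Rightarrow> int) \<Rightarrow> (nat \<Rightarrow> int)" where
  "zm_mul m x y = (\<lambda>k. (x k * y k) mod \<bar>m\<bar> ^ k)"

definition zm_gcd_is :: "int \<Rightarrow> (nat \<Rightarrow> int) \<Rightarrow> int \<Rightarrow> bool" where
  "zm_gcd_is m \<xi> d \<longleftrightarrow> d > 0 \<and> d dvd m \<and>
     {zm_add m (zm_mul m (zm_of_int m m) u) (zm_mul m \<xi> v) | u v. u \<in> Zm m \<and> v \<in> Zm m}
       = {zm_mul m (zm_of_int m d) w | w. w \<in> Zm m}"

definition zm_cong :: "int \<Rightarrow> int \<Rightarrow> (nat \<Rightarrow> int) \<Rightarrow> (nat \<Rightarrow> int) \<Rightarrow> bool" where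
  "zm_cong m N \<xi> \<xi>' \<longleftrightarrow> (\<exists>w \<in> Zm m. \<xi> = zm_add m \<xi>' (zm_mul m (zm_of_int m N) w))"

definition zm_tendsto :: "int \<Rightarrow> (nat \<Rightarrow> int) \<Rightarrow> (nat \<Rightarrow> int) \<Rightarrow> bool" where
  "zm_tendsto m xs \<xi> \<longleftrightarrow> (\<forall>k. eventually (\<lambda>n. xs n mod \<bar>m\<bar> ^ k = \<xi> k) sequentially)"

datatype gen = GA | GB

text \<open>A letter is a generator together with an exponent sign (True = inverse).\<close>
type_synonym letter = "gen \<times> bool"
type_synonym word = "letter list"

definition inv_letter :: "letter \<Rightarrow> letter" where
  "inv_letter l = (fst l, \<not> snd l)"

definition inv_word :: "word \<Rightarrow> word" where
  "inv_word w = rev (map inv_letter w)"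

fun reduced :: "word \<Rightarrow> bool" where
  "reduced [] = True"
| "reduced [x] = True"
| "reduced (x # y # w) = (y \<noteq> inv_letter x \<and> reduced (y # w))"

definition gen_pow :: "gen \<Rightarrow> int \<Rightarrow> word" where
  "gen_pow g p = (if p \<ge> 0 then replicate (nat p) (g, False) else replicate (nat (- p)) (g, True))"

inductive pres_step :: "word set \<Rightarrow> word \<Rightarrow> word \<Rightarrow> bool" for R where
  "s \<in> R \<Longrightarrow> pres_step R (u @ v) (u @ s @ v)"
| "s \<in> R \<Longrightarrow> pres_step R (u @ v) (u @ inv_word s @ v)"
| "pres_step R (u @ v) (u @ [x, inv_letter x] @ v)"

definition pres_equiv :: "word set \<Rightarrow> word \<Rightarrow> word \<Rightarrow> bool" where
  "pres_equiv R = equivclp (pres_step R)"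

text \<open>Normal subgroup of F(a,b) (as its set of reduced words) normally generated by R.\<close>

definition normal_closure :: "word set \<Rightarrow> word set" where
  "normal_closure R = {w. reduced w \<and> pres_equiv R w []}"

definition BS_rel :: "int \<Rightarrow> int \<Rightarrow> word" where
  "BS_rel p q = [(GA, False)] @ gen_pow GB p @ [(GA, True)] @ gen_pow GB (- q)"

text \<open>BS(p,q) marked by (a,b), viewed as a normal subgroup of F(a,b).\<close>

definition BS :: "int \<Rightarrow> int \<Rightarrow> word set" where
  "BS p q = normal_closure {BS_rel p q}"

text \<open>The limit of BS(m, xi_n) in G_2 for |xi_n| \<rightarrow> \<infinity>, xi_n \<rightarrow> xi in Z_m.
 Convergence in G_2 means: for each word w, eventually w \<in> N_n iff w \<in> N.
 Since the limit exists and does not depend on the sequence, it is the set of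
 reduced words lying eventually in BS(m, xi_n) for every such sequence.\<close>

definition BSbar :: "int \<Rightarrow> (nat \<Rightarrow> int) \<Rightarrow> word set" where
  "BSbar m \<xi> = {w. reduced w \<and>
      (\<forall>xs. (\<forall>B. eventually (\<lambda>n. \<bar>xs n\<bar> \<ge> B) sequentially) \<and> zm_tendsto m xs \<xi>
            \<longrightarrow> eventually (\<lambda>n. w \<in> BS m (xs n)) sequentially)}"

definition same_relations_upto :: "nat \<Rightarrow> word set \<Rightarrow> word set \<Rightarrow> bool" where
  "same_relations_upto L N1 N2 \<longleftrightarrow>
     (\<forall>w. reduced w \<and> length w \<le> L \<longrightarrow> (w \<in> N1 \<longleftrightarrow> w \<in> N2))"

end

theory Submission
  imports Defs
begin

text \<open>
  Put U_0 = n and U_(i+1) = n * (U_i div m). Reducing a word in BS(m, n) to its HNN normal form only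
  produces exponents k + sum c_i U_i of b: conjugating by a turns b^(U_i - U_i mod m) into b^(U_(i+1)).
  For |n| large such an exponent is divisible by n iff k = 0, and its class mod m is read off
  from the residues U_i mod m. So the reduction depends on n only through these residues, where the
  index i is smaller than the number of letters a^-1. Finally, for gcd(m, n) = d, the residues with
  i < h determine and are determined by n modulo (m/d)^h d. Conversely, the j-th residue is detected
  by whether a b^(U_j - r_j) a^-1 commutes with b, which is the source of the length bound in (1).
\<close>

section \<open>The normal form action of BS(p, q)\<close>

text \<open>Remainders of least absolute value: crem n k = k as soon as |n| > 2|k|, whatever the signs.\<close>

definition crem :: "int \<Rightarrow> int \<Rightarrow> int" where
  "crem N s = (s + (\<bar>N\<bar> - 1) div 2) mod \<bar>N\<bar> - (\<bar>N\<bar> - 1) div 2"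

definition cquo :: "int \<Rightarrow> int \<Rightarrow> int" where
  "cquo N s = (s - crem N s) div N"

lemma crem_add_mult [simp]: "crem N (s + N * k) = crem N s"
proof -
  have "s + N * k + (\<bar>N\<bar> - 1) div 2 = s + (\<bar>N\<bar> - 1) div 2 + \<bar>N\<bar> * (sgn N * k)"
    by (simp add: abs_sgn mult.assoc[symmetric] sgn_if)
  then show ?thesis unfolding crem_def by (metis mod_mult_self2)
qed

lemma dvd_diff_crem: "N dvd s - crem N s"
proof -
  have "\<bar>N\<bar> dvd (s + (\<bar>N\<bar> - 1) div 2) - (s + (\<bar>N\<bar> - 1) div 2) mod \<bar>N\<bar>"
    by (rule dvd_minus_mod)
  then show ?thesis unfolding crem_def abs_dvd_iff by (simp only: diff_diff_eq2)
qed

lemma crem_cquo: "s = crem N s + N * cquo N s"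
  using dvd_diff_crem[of N s] by (simp add: cquo_def)

lemma crem_crem [simp]: "crem N (crem N s) = crem N s"
  by (metis crem_add_mult crem_cquo)

lemma crem_small: "2 * \<bar>x\<bar> < \<bar>N\<bar> \<Longrightarrow> crem N x = x"
  unfolding crem_def by (subst mod_pos_pos_trivial) auto

lemma crem_eq_0_iff: "N \<noteq> 0 \<Longrightarrow> crem N s = 0 \<longleftrightarrow> N dvd s"
  by (metis crem_add_mult crem_small add_0 dvdE abs_0 dvd_diff_crem diff_zero mult_zero_right zero_less_abs_iff)

lemma cquo_eq: "N \<noteq> 0 \<Longrightarrow> crem N r = r \<Longrightarrow> cquo N (r + N * t) = t"
  by (simp add: cquo_def)

lemma cquo_add_mult: "N \<noteq> 0 \<Longrightarrow> cquo N (s + N * k) = cquo N s + k"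
  by (metis crem_cquo crem_crem cquo_eq add.assoc distrib_left)

type_synonym state = "(bool \<times> int) list \<times> int"

text \<open>The powers of \<open>b\<close> that can be moved to the right across
  \<open>(GA, e)\<close> are the multiples of this number; beyond the letter they are multiples of
  \<open>edge_index p q (\<not> e)\<close>.\<close>

definition edge_index :: "int \<Rightarrow> int \<Rightarrow> bool \<Rightarrow> int" where
  "edge_index p q e = (if e then p else q)"

fun pinch :: "bool \<Rightarrow> (bool \<times> int) list \<Rightarrow> bool" where
  "pinch e [] = False"
| "pinch e (x # st) = (fst x = (\<not> e))"

text \<open>The state (st, s) with st = [(e_k, r_k), ..., (e_1, r_1)] stands for the normal form
  b^(r_1) a^(e_1) ... b^(r_k) a^(e_k) b^s, on which letters act by right multiplication.\<close>

fun act :: "int \<Rightarrow> int \<Rightarrow> letter \<Rightarrow> state \<Rightarrow> state" where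
  "act p q (GB, e) (st, s) = (st, s + (if e then - 1 else 1))"
| "act p q (GA, e) (st, s) =
     (let r = crem (edge_index p q e) s; s' = edge_index p q (\<not> e) * cquo (edge_index p q e) s
      in if r = 0 \<and> pinch e st then (tl st, snd (hd st) + s') else ((e, r) # st, s'))"

definition run :: "int \<Rightarrow> int \<Rightarrow> word \<Rightarrow> state \<Rightarrow> state" where
  "run p q w S = fold (act p q) w S"

lemma run_simps [simp]:
  "run p q [] S = S"
  "run p q (x # w) S = run p q w (act p q x S)"
  "run p q (u @ v) S = run p q v (run p q u S)"
  by (simp_all add: run_def)

text \<open>Normal forms of an HNN extension: fixed coset representatives, and no pair of inverse
  letters \<open>a\<close> around \<open>b^0\<close>.\<close>

fun normal_stack :: "int \<Rightarrow> int \<Rightarrow> (bool \<times> int) list \<Rightarrow> bool" where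
  "normal_stack p q [] = True"
| "normal_stack p q (x # st) = (crem (edge_index p q (fst x)) (snd x) = snd x \<and>
     \<not> (snd x = 0 \<and> pinch (fst x) st) \<and> normal_stack p q st)"

lemma normal_stack_act:
  "normal_stack p q (fst S) \<Longrightarrow> normal_stack p q (fst (act p q x S))"
  by (cases "(p, q, x, S)" rule: act.cases; cases "fst S") (auto simp: Let_def)

lemma normal_stack_run:
  "normal_stack p q (fst S) \<Longrightarrow> normal_stack p q (fst (run p q w S))"
  by (induction w arbitrary: S) (auto simp: normal_stack_act)

lemma run_gen_pow_GB [simp]: "run p q (gen_pow GB k) (st, s) = (st, s + k)"
proof -
  have "run p q (replicate l (GB, e)) (st, s) = (st, s + (if e then - int l else int l))" for l e s
    by (induction l arbitrary: s) auto
  then show ?thesis by (simp add: gen_pow_def)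
qed

text \<open>A multiple of the edge index changes the quotient but not the remainder, so the choice
  between push and pop stays the same.\<close>

lemma act_GA_add_mult:
  assumes "p \<noteq> 0" "q \<noteq> 0" and "act p q (GA, e) (st, s) = (st', s')"
  shows "act p q (GA, e) (st, s + edge_index p q e * k) = (st', s' + edge_index p q (\<not> e) * k)"
proof -
  have "edge_index p q e \<noteq> 0" using assms by (simp add: edge_index_def)
  then show ?thesis using assms(3)
    by (auto simp: Let_def cquo_add_mult distrib_left split: if_splits)
qed

text \<open>After a push the exponent is a multiple of the other edge index, so the inverse letter
  pops. After a pop, normality says that the removed entry was a least remainder without a pinch, so
  the inverse letter pushes it back.\<close>

lemma act_inv_letter:
  assumes "p \<noteq> 0" "q \<noteq> 0" and "normal_stack p q st"
  shows "act p q (inv_letter x) (act p q x (st, s)) = (st, s)"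
proof (cases x)
  case (Pair g e)
  show ?thesis
  proof (cases g)
    case GB
    then show ?thesis by (simp add: Pair inv_letter_def)
  next
    case GA
    let ?N = "edge_index p q e" and ?N' = "edge_index p q (\<not> e)"
    have nz: "?N \<noteq> 0" "?N' \<noteq> 0" using assms by (auto simp: edge_index_def)
    have s: "s = crem ?N s + ?N * cquo ?N s" by (rule crem_cquo)
    have 0: "crem ?N' (?N' * t) = 0" "cquo ?N' (?N' * t) = t" for t
      using cquo_eq[of ?N' 0 t] nz by (auto simp: crem_eq_0_iff)
    show ?thesis
    proof (cases "crem ?N s = 0 \<and> pinch e st")
      case False
      then show ?thesis using 0 by (auto simp: Pair GA inv_letter_def Let_def simp flip: s)
    next
      case True
      then obtain r st' where st: "st = (\<not> e, r) # st'"
        by (cases st) auto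
      have r: "crem ?N' r = r" "\<not> (r = 0 \<and> pinch (\<not> e) st')" using assms(3) st by auto
      have "edge_index p q e * cquo ?N s = s" using True s by simp
      then show ?thesis using True r nz
        by (auto simp: Pair GA inv_letter_def Let_def st cquo_eq)
    qed
  qed
qed

lemma run_inv_word:
  assumes "p \<noteq> 0" "q \<noteq> 0" and "normal_stack p q (fst S)"
  shows "run p q (inv_word w) (run p q w S) = S"
  using assms(3)
proof (induction w arbitrary: S)
  case (Cons x w)
  then show ?case using assms(1,2) act_inv_letter[of p q "fst S" x "snd S"]
    by (simp add: inv_word_def normal_stack_act)
qed (simp add: inv_word_def)

text \<open>The letters \<open>a\<close> and \<open>a^-1\<close> undo each other; the
  \<open>b^p\<close> between them crosses \<open>a^-1\<close> as \<open>b^q\<close>, which the tail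
  \<open>b^(-q)\<close> removes.\<close>

lemma run_BS_rel:
  assumes "p \<noteq> 0" "q \<noteq> 0" and "normal_stack p q (fst S)"
  shows "run p q (BS_rel p q) S = S"
proof -
  obtain st s where S: "S = (st, s)" by fastforce
  obtain st1 s1 where 1: "act p q (GA, False) (st, s) = (st1, s1)" by fastforce
  have "act p q (GA, True) (st1, s1) = (st, s)"
    using act_inv_letter[of p q st "(GA, False)" s] assms 1 S by (simp add: inv_letter_def)
  from act_GA_add_mult[OF assms(1,2) this, of 1]
  have "act p q (GA, True) (st1, s1 + p) = (st, s + q)" by (simp add: edge_index_def)
  then show ?thesis by (simp del: act.simps add: BS_rel_def S 1)
qed

text \<open>Relators and cancelling pairs act as the identity on normal states, so the action
  factors through BS(p, q).\<close>

lemma run_pres_equiv: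
  assumes "p \<noteq> 0" "q \<noteq> 0" and "pres_equiv {BS_rel p q} u v" and "normal_stack p q (fst S)"
  shows "run p q u S = run p q v S"
proof -
  have step: "run p q u S = run p q v S" if "pres_step {BS_rel p q} u v" for u v
    using that
  proof cases
    case (1 s u' v')
    then show ?thesis using assms run_BS_rel normal_stack_run by simp
  next
    case (2 s u' v')
    then show ?thesis using assms run_BS_rel normal_stack_run
      by simp (metis run_inv_word)
  next
    case (3 u' v' x)
    have "act p q (inv_letter x) (act p q x (run p q u' S)) = run p q u' S"
      using act_inv_letter[OF assms(1,2) normal_stack_run[OF assms(4)]] by (metis prod.collapse)
    then show ?thesis using 3 by simp
  qed
  show ?thesis using assms(3) unfolding pres_equiv_def
    by (induction rule: equivclp_induct) (auto dest: step)
qed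

section \<open>Calculus with words modulo relators\<close>

lemma pres_equiv_refl [simp, intro]: "pres_equiv R u u"
  by (simp add: pres_equiv_def)

lemma pres_equiv_sym: "pres_equiv R u v \<Longrightarrow> pres_equiv R v u"
  unfolding pres_equiv_def by (rule equivclp_sym)

lemma pres_equiv_trans [trans]: "pres_equiv R u v \<Longrightarrow> pres_equiv R v w \<Longrightarrow> pres_equiv R u w"
  unfolding pres_equiv_def by (rule equivclp_trans)

lemma pres_step_context: "pres_step R u v \<Longrightarrow> pres_step R (x @ u @ y) (x @ v @ y)"
proof (induction rule: pres_step.induct)
  case (1 s u v) then show ?case using pres_step.intros(1)[of s R "x @ u" "v @ y"] by simp
next
  case (2 s u v) then show ?case using pres_step.intros(2)[of s R "x @ u" "v @ y"] by simp
next
  case (3 u v z) then show ?case using pres_step.intros(3)[of R "x @ u" "v @ y" z] by simp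
qed

lemma pres_equiv_context: "pres_equiv R u v \<Longrightarrow> pres_equiv R (x @ u @ y) (x @ v @ y)"
  unfolding pres_equiv_def
proof (induction rule: equivclp_induct)
  case (step v w)
  then show ?case by (meson pres_step_context equivclp_into_equivclp)
qed simp

lemma pres_equiv_append:
  "pres_equiv R u u' \<Longrightarrow> pres_equiv R v v' \<Longrightarrow> pres_equiv R (u @ v) (u' @ v')"
  using pres_equiv_context[of R u u' "[]" v] pres_equiv_context[of R v v' u' "[]"]
  by (metis append_Nil append_Nil2 pres_equiv_trans)

lemma pres_equiv_cancel: "pres_equiv R [x, inv_letter x] []"
proof -
  have "pres_step R [] [x, inv_letter x]" using pres_step.intros(3)[of R "[]" "[]" x] by simp
  then show ?thesis unfolding pres_equiv_def by (metis equivclp_sym r_into_equivclp)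
qed

lemma pres_equiv_rel: "s \<in> R \<Longrightarrow> pres_equiv R s []"
  using pres_step.intros(1)[of s R "[]" "[]"] unfolding pres_equiv_def
  by (metis append_Nil append_Nil2 equivclp_sym r_into_equivclp)

lemma inv_letter_inv_letter [simp]: "inv_letter (inv_letter x) = x"
  by (simp add: inv_letter_def)

lemma pres_equiv_inv_word: "pres_equiv R (w @ inv_word w) []"
proof (induction w)
  case (Cons x w)
  have "pres_equiv R ([x] @ (w @ inv_word w) @ [inv_letter x]) ([x] @ [] @ [inv_letter x])"
    by (rule pres_equiv_context[OF Cons])
  from pres_equiv_trans[OF this] show ?case using pres_equiv_cancel[of R x]
    by (simp add: inv_word_def)
qed (simp add: inv_word_def)

lemma inv_word_inv_word [simp]: "inv_word (inv_word w) = w"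
  by (simp add: inv_word_def rev_map o_def)

lemma pres_equiv_inv_word': "pres_equiv R (inv_word w @ w) []"
  using pres_equiv_inv_word[of R "inv_word w"] by simp

lemma inv_word_gen_pow: "inv_word (gen_pow g k) = gen_pow g (- k)"
  by (auto simp: inv_word_def gen_pow_def inv_letter_def)

lemma inv_word_append: "inv_word (u @ v) = inv_word v @ inv_word u"
  by (simp add: inv_word_def)

text \<open>The word \<open>inv_word u @ v @ inv_word v\<close> cancels on the right to
  \<open>inv_word u\<close> and, once its first \<open>v\<close> is replaced by \<open>u\<close>, on
  the left to \<open>inv_word v\<close>.\<close>

lemma pres_equiv_inv_cong:
  assumes "pres_equiv R u v"
  shows "pres_equiv R (inv_word u) (inv_word v)"
proof -
  have "pres_equiv R (inv_word u @ v @ inv_word v) (inv_word u @ u @ inv_word v)"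
    using assms by (intro pres_equiv_context) (rule pres_equiv_sym)
  from pres_equiv_trans[OF this] have "pres_equiv R (inv_word u @ v @ inv_word v) (inv_word v)"
    using pres_equiv_context[OF pres_equiv_inv_word'[of R u], of "[]" "inv_word v"] by simp
  moreover have "pres_equiv R (inv_word u @ v @ inv_word v) (inv_word u)"
    using pres_equiv_context[OF pres_equiv_inv_word[of R v], of "inv_word u" "[]"] by simp
  ultimately show ?thesis by (metis pres_equiv_trans pres_equiv_sym)
qed

lemma gen_pow_0 [simp]: "gen_pow g 0 = []"
  by (simp add: gen_pow_def)

lemma gen_pow_of_nat:
  "gen_pow g (int j) = replicate j (g, False)" "gen_pow g (- int j) = replicate j (g, True)"
  by (auto simp: gen_pow_def)

lemma gen_pow_letter:
  "pres_equiv R (gen_pow g k @ [(g, e)]) (gen_pow g (k + (if e then - 1 else 1)))"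
proof -
  \<comment> \<open>The sign of the new letter: for \<open>?\<epsilon> * k \<ge> 0\<close> the
    letter extends the power, otherwise it cancels against the last letter of
    \<open>gen_pow g k\<close>.\<close>
  let ?\<epsilon> = "if e then - 1 else 1 :: int"
  have same: "gen_pow g (?\<epsilon> * int j) @ [(g, e)] = gen_pow g (?\<epsilon> * int (Suc j))" for j
    using gen_pow_of_nat[of g j] gen_pow_of_nat[of g "Suc j"]
    by (simp add: replicate_append_same)
  have opp: "gen_pow g (- ?\<epsilon> * int (Suc j)) = gen_pow g (- ?\<epsilon> * int j) @ [(g, \<not> e)]" for j
    using gen_pow_of_nat[of g j] gen_pow_of_nat[of g "Suc j"]
    by (simp add: replicate_append_same add.commute)
  show ?thesis
  proof (cases "?\<epsilon> * k \<ge> 0")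
    case True
    then obtain j where "?\<epsilon> * k = int j" by (metis zero_le_imp_eq_int)
    then have "k = ?\<epsilon> * int j" by (auto split: if_splits)
    then show ?thesis using same[of j] by (auto simp: algebra_simps)
  next
    case False
    then obtain j where "- ?\<epsilon> * k = int (Suc j)"
      by (metis mult_minus_left neg_0_less_iff_less not_le zero_less_imp_eq_int gr0_implies_Suc)
    then have k: "k = - ?\<epsilon> * int (Suc j)" by (auto split: if_splits)
    then have k': "k + ?\<epsilon> = - ?\<epsilon> * int j" by auto
    show ?thesis unfolding k' unfolding k opp
      using pres_equiv_context[OF pres_equiv_cancel[of R "(g, \<not> e)"], of "gen_pow g (- ?\<epsilon> * int j)" "[]"]
      by (simp add: inv_letter_def)
  qed
qed

lemma gen_pow_add: "pres_equiv R (gen_pow g k @ gen_pow g l) (gen_pow g (k + l))"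
proof -
  have "pres_equiv R (gen_pow g k @ replicate j (g, e)) (gen_pow g (k + (if e then - int j else int j)))"
    for j e
  proof (induction j)
    case (Suc j)
    have "pres_equiv R ((gen_pow g k @ replicate j (g, e)) @ [(g, e)])
        (gen_pow g (k + (if e then - int j else int j)) @ [(g, e)])"
      using pres_equiv_append[OF Suc] by simp
    also have "pres_equiv R \<dots> (gen_pow g (k + (if e then - int j else int j) + (if e then - 1 else 1)))"
      by (rule gen_pow_letter)
    finally show ?case by (simp add: replicate_append_same algebra_simps split: if_splits)
  qed simp
  from this[of "nat \<bar>l\<bar>" "l < 0"] show ?thesis by (auto simp: gen_pow_def)
qed

lemma gen_pow_diff:
  "pres_equiv R (u @ gen_pow g k @ gen_pow g (l - k) @ v) (u @ gen_pow g l @ v)"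
  using pres_equiv_context[OF gen_pow_add[of R g k "l - k"], of u v] by simp

section \<open>Normal forms decide triviality in BS(p, q)\<close>

lemma BS_conj:
  "pres_equiv {BS_rel p q} (gen_pow GB (q * t) @ [(GA, False)]) ([(GA, False)] @ gen_pow GB (p * t))"
proof -
  let ?eq = "pres_equiv {BS_rel p q}"
  let ?b = "gen_pow GB" and ?a = "[(GA, False)]" and ?A = "[(GA, True)]"
  have base: "?eq (?b q @ ?a) (?a @ ?b p)"
  proof -
    have "?eq (?a @ ?b p @ ?A @ ?b (- q)) []"
      using pres_equiv_rel[of "BS_rel p q" "{BS_rel p q}"] by (simp add: BS_rel_def)
    from pres_equiv_context[OF this, of "[]" "?b q @ ?a"]
    have "?eq ((?a @ ?b p @ ?A) @ (?b (- q) @ ?b q) @ ?a) (?b q @ ?a)" by simp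
    moreover have "?eq ((?a @ ?b p @ ?A) @ (?b (- q) @ ?b q) @ ?a) ((?a @ ?b p @ ?A) @ [] @ ?a)"
      using gen_pow_add[of _ GB "- q" q] by (intro pres_equiv_context) simp
    moreover have "?eq ((?a @ ?b p) @ (?A @ ?a) @ []) ((?a @ ?b p) @ [] @ [])"
      using pres_equiv_cancel[of _ "(GA, True)"] by (intro pres_equiv_context) (simp add: inv_letter_def)
    ultimately show ?thesis by simp (meson pres_equiv_trans pres_equiv_sym)
  qed
  have nat: "?eq (?b (q * int t) @ ?a) (?a @ ?b (p * int t))" for t
  proof (induction t)
    case (Suc t)
    have "?eq (?b (q * int (Suc t)) @ ?a) (?b (q * int t) @ ?b q @ ?a)"
      using gen_pow_diff[of _ "[]" GB "q * int t" "q * int (Suc t)" ?a]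
      by (simp add: algebra_simps pres_equiv_sym)
    also have "?eq \<dots> (?b (q * int t) @ ?a @ ?b p)"
      by (intro pres_equiv_append base pres_equiv_refl)
    also have "?eq \<dots> (?a @ ?b (p * int t) @ ?b p)"
      using pres_equiv_append[OF Suc pres_equiv_refl[of _ "?b p"]] by simp
    also have "?eq \<dots> (?a @ ?b (p * int (Suc t)))"
      using gen_pow_diff[of _ ?a GB "p * int t" "p * int (Suc t)" "[]"]
      by (simp add: algebra_simps)
    finally show ?case .
  qed simp
  show ?thesis
  proof (cases "t \<ge> 0")
    case True
    then show ?thesis using nat[of "nat t"] by simp
  next
    case False
    \<comment> \<open>For negative \<open>t\<close>, \<open>b^(-pt) b^(pt)\<close> is inserted after
      \<open>a\<close>; the first factor is moved back across \<open>a\<close> by the nonnegative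
      case and cancels \<open>b^(qt)\<close>.\<close>
    have n: "?eq (?b (q * - t) @ ?a) (?a @ ?b (p * - t))" using nat[of "nat (- t)"] False by simp
    have "?eq (?b (q * t) @ ?a) (?b (q * t) @ ?a @ ?b (p * - t) @ ?b (p * t))"
      using gen_pow_diff[of _ "?b (q * t) @ ?a" GB "p * - t" 0 "[]"] by (simp add: pres_equiv_sym)
    also have "?eq \<dots> (?b (q * t) @ ?b (q * - t) @ ?a @ ?b (p * t))"
      using pres_equiv_context[OF n, of "?b (q * t)" "?b (p * t)"] by (simp add: pres_equiv_sym)
    also have "?eq \<dots> (?a @ ?b (p * t))"
      using gen_pow_diff[of _ "[]" GB "q * t" 0 "?a @ ?b (p * t)"] by simp
    finally show ?thesis .
  qed
qed

lemma BS_conj_edge: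
  "pres_equiv {BS_rel p q} (gen_pow GB (edge_index p q e * t) @ [(GA, e)])
     ([(GA, e)] @ gen_pow GB (edge_index p q (\<not> e) * t))"
proof (cases e)
  case False
  then show ?thesis using BS_conj[of p q t] by (simp add: edge_index_def)
next
  case True
  let ?eq = "pres_equiv {BS_rel p q}"
  let ?b = "gen_pow GB" and ?a = "[(GA, False)]" and ?A = "[(GA, True)]"
  \<comment> \<open>Inserting \<open>a^-1 a\<close> in front reduces the claim to
    \<open>BS_conj\<close>, used from right to left.\<close>
  have "?eq (?b (p * t) @ ?A) (?A @ ?a @ ?b (p * t) @ ?A)"
    using pres_equiv_context[OF pres_equiv_cancel[of _ "(GA, True)"], of _ "[]" "?b (p * t) @ ?A"]
    by (simp add: inv_letter_def pres_equiv_sym)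
  also have "?eq \<dots> (?A @ ?b (q * t) @ ?a @ ?A)"
    using pres_equiv_context[OF BS_conj[of p q t], of ?A ?A] by (simp add: pres_equiv_sym)
  also have "?eq \<dots> (?A @ ?b (q * t))"
    using pres_equiv_context[OF pres_equiv_cancel[of _ "(GA, False)"], of _ "?A @ ?b (q * t)" "[]"]
    by (simp add: inv_letter_def)
  finally show ?thesis using True by (simp add: edge_index_def)
qed

fun stack_word :: "(bool \<times> int) list \<Rightarrow> word" where
  "stack_word [] = []"
| "stack_word ((e, r) # st) = stack_word st @ gen_pow GB r @ [(GA, e)]"

definition state_word :: "state \<Rightarrow> word" where
  "state_word S = stack_word (fst S) @ gen_pow GB (snd S)"

text \<open>Each rule of \<open>act\<close> is an identity in the group: the remainder stays, the
  multiple of the edge index crosses the letter, and a pop is a free cancellation.\<close>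

lemma state_word_act:
  "pres_equiv {BS_rel p q} (state_word S @ [x]) (state_word (act p q x S))"
proof -
  let ?eq = "pres_equiv {BS_rel p q}"
  let ?b = "gen_pow GB"
  obtain st s where S: "S = (st, s)" by fastforce
  obtain g e where x: "x = (g, e)" by fastforce
  show ?thesis
  proof (cases g)
    case GB
    then show ?thesis using pres_equiv_context[OF gen_pow_letter[of _ GB s e], of _ "stack_word st" "[]"]
      by (simp add: S x state_word_def)
  next
    case GA
    define r t N' where "r = crem (edge_index p q e) s" and "t = cquo (edge_index p q e) s"
      and "N' = edge_index p q (\<not> e)"
    have s: "s = r + edge_index p q e * t" unfolding r_def t_def by (rule crem_cquo)
    have "?eq (stack_word st @ ?b s @ [(GA, e)])
        (stack_word st @ ?b r @ ?b (edge_index p q e * t) @ [(GA, e)])"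
      using gen_pow_diff[of _ "stack_word st" GB r s "[(GA, e)]"] s by (simp add: pres_equiv_sym)
    also have "?eq \<dots> (stack_word st @ ?b r @ [(GA, e)] @ ?b (N' * t))"
      unfolding N'_def by (intro pres_equiv_append BS_conj_edge pres_equiv_refl)
    finally have push: "?eq (state_word S @ [x]) (stack_word st @ ?b r @ [(GA, e)] @ ?b (N' * t))"
      by (simp add: S x GA state_word_def)
    show ?thesis
    proof (cases "r = 0 \<and> pinch e st")
      case False
      then have "act p q x S = ((e, r) # st, N' * t)"
        by (auto simp: S x GA Let_def r_def t_def N'_def)
      then show ?thesis using push by (simp add: state_word_def)
    next
      case True
      then obtain r' st' where st: "st = (\<not> e, r') # st'" by (cases st) auto
      have a: "act p q x S = (st', r' + N' * t)"
        using True by (auto simp: S x GA Let_def r_def t_def N'_def st)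
      have "?eq (stack_word st @ ?b r @ [(GA, e)] @ ?b (N' * t))
          (stack_word st' @ ?b r' @ ?b (N' * t))"
        using pres_equiv_context[OF pres_equiv_cancel[of _ "(GA, \<not> e)"], of _ "stack_word st' @ ?b r'" "?b (N' * t)"]
        using True by (simp add: st inv_letter_def)
      also have "?eq \<dots> (stack_word st' @ ?b (r' + N' * t))"
        by (intro pres_equiv_append gen_pow_add pres_equiv_refl)
      finally show ?thesis using pres_equiv_trans[OF push] by (simp add: a state_word_def)
    qed
  qed
qed

lemma state_word_run:
  "pres_equiv {BS_rel p q} (state_word S @ w) (state_word (run p q w S))"
proof (induction w arbitrary: S)
  case (Cons x w)
  have "pres_equiv {BS_rel p q} ((state_word S @ [x]) @ w) (state_word (act p q x S) @ w)"
    by (intro pres_equiv_append state_word_act pres_equiv_refl)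
  also note Cons
  finally show ?case by simp
qed simp

text \<open>A trivial word acts trivially by \<open>run_pres_equiv\<close>; conversely any word
  equals the word of its final state, which is empty for \<open>([], 0)\<close>.\<close>

lemma BS_trivial_iff_run:
  assumes "p \<noteq> 0" "q \<noteq> 0"
  shows "pres_equiv {BS_rel p q} w [] \<longleftrightarrow> run p q w ([], 0) = ([], 0)"
  using run_pres_equiv[OF assms, of w "[]" "([], 0)"] state_word_run[of p q "([], 0)" w]
  by (auto simp: state_word_def)

section \<open>Reduction in BS(m, n) for large n\<close>

primrec U :: "int \<Rightarrow> int \<Rightarrow> nat \<Rightarrow> int" where
  "U m n 0 = n"
| "U m n (Suc i) = n * (U m n i div m)"

text \<open>The difference loses a factor \<open>mh\<close> in the division by \<open>m\<close> and
  gains a factor \<open>nh\<close> in the multiplication by \<open>n\<close>. Only this leading term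
  is tracked; the rest goes into \<open>z\<close>.\<close>

lemma U_diff:
  assumes m: "m = mh * d" "m \<noteq> 0" and n: "n = nh * d" and n': "n' = n + mh ^ J * d * k"
  shows "i \<le> J \<Longrightarrow> \<exists>z. U m n' i - U m n i = d * mh ^ (J - i) * (k * nh ^ i + mh * z)"
proof (induction i)
  case 0
  show ?case by (rule exI[of _ 0]) (simp add: n')
next
  case (Suc i)
  define l where "l = J - Suc i"
  have J: "J - i = Suc l" "J = l + 1 + i" using Suc.prems by (auto simp: l_def)
  obtain z where z: "U m n' i - U m n i = d * mh ^ (J - i) * (k * nh ^ i + mh * z)"
    using Suc by auto
  \<comment> \<open>The difference divided by \<open>m\<close>; it is integral because
    \<open>i < J\<close> leaves a factor \<open>mh\<close>.\<close>
  define y where "y = mh ^ l * (k * nh ^ i + mh * z)"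
  have "U m n' i = U m n i + m * y" using z by (simp add: y_def m J algebra_simps)
  then have div: "U m n' i div m = U m n i div m + y" using m(2) by simp
  let ?D = "U m n i div m"
  \<comment> \<open>The change of \<open>n\<close> itself contributes a multiple of
    \<open>mh ^ J\<close>, hence of \<open>mh ^ (l + 1)\<close>, which the new \<open>z\<close>
    absorbs.\<close>
  have "U m n' (Suc i) - U m n (Suc i) = n * y + mh ^ J * d * k * (?D + y)"
    using div by (simp add: n' algebra_simps)
  also have "\<dots> = d * mh ^ l * (k * nh ^ Suc i + mh * (nh * z + mh ^ i * k * (?D + y)))"
    by (subst (1) y_def) (simp add: n J(2) power_add algebra_simps)
  finally show ?case unfolding l_def by blast
qed

text \<open>Induction on \<open>h\<close>: once \<open>n' - n = mh ^ h * d * k\<close>,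
  \<open>U_diff\<close> shows that the residues of index \<open>h\<close> agree iff
  \<open>mh\<close> divides \<open>k * nh ^ h\<close>. As \<open>mh\<close> and \<open>nh\<close>
  are coprime, this means \<open>mh dvd k\<close>, that is, one more factor \<open>mh\<close> in
  \<open>n' - n\<close>.\<close>

lemma U_residues_eq_iff:
  assumes m: "m \<noteq> 0" and d: "gcd m n = d" "gcd m n' = d"
  shows "(\<forall>i<h. U m n' i mod m = U m n i mod m) \<longleftrightarrow> (m div d) ^ h * d dvd n' - n"
proof -
  have d0: "d \<noteq> 0" using m d by auto
  define mh nh where "mh = m div d" and "nh = n div d"
  have mn: "m = mh * d" "n = nh * d" using d unfolding mh_def nh_def
    by (metis gcd_dvd1 dvd_div_mult_self, metis gcd_dvd2 dvd_div_mult_self)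
  have cop: "coprime mh nh" unfolding mh_def nh_def using div_gcd_coprime[of m n] m d by auto
  have "(\<forall>i<h. U m n' i mod m = U m n i mod m) \<longleftrightarrow> mh ^ h * d dvd n' - n"
  proof (induction h)
    case 0
    have "d dvd n" "d dvd n'" using d by (metis gcd_dvd2)+
    then show ?case by simp
  next
    case (Suc h)
    show ?case
    proof (cases "mh ^ h * d dvd n' - n")
      case False
      have "mh ^ h * d dvd mh ^ Suc h * d" by simp
      with False have "\<not> mh ^ Suc h * d dvd n' - n" using dvd_trans by blast
      moreover have "\<not> (\<forall>i<h. U m n' i mod m = U m n i mod m)" using Suc False by simp
      ultimately show ?thesis using less_SucI by blast
    next
      case True
      then obtain k where "n' - n = mh ^ h * d * k" by blast
      then have k: "n' = n + mh ^ h * d * k" by simp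
      obtain z where z: "U m n' h - U m n h = d * (k * nh ^ h + mh * z)"
        using U_diff[OF mn(1) m mn(2) k order.refl] by auto
      have mh: "mh \<noteq> 0" using m mn by auto
      have "U m n' h mod m = U m n h mod m \<longleftrightarrow> d * mh dvd d * (k * nh ^ h + mh * z)"
        using z mn by (simp add: mod_eq_dvd_iff mult.commute)
      also have "\<dots> \<longleftrightarrow> mh dvd k * nh ^ h"
        using d0 by (simp add: dvd_add_left_iff)
      also have "\<dots> \<longleftrightarrow> mh dvd k"
        using cop by (simp add: coprime_dvd_mult_left_iff)
      also have "\<dots> \<longleftrightarrow> mh ^ Suc h * d dvd n' - n"
        using mh d0 by (simp add: k mult.assoc mult.left_commute)
      finally show ?thesis using Suc True by (auto simp: less_Suc_eq)
    qed
  qed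
  then show ?thesis by (simp add: mh_def)
qed

section \<open>Linear combinations of the \<open>U_i\<close>\<close>

fun U_sum :: "int \<Rightarrow> int \<Rightarrow> nat \<Rightarrow> int list \<Rightarrow> int" where
  "U_sum m n j [] = 0"
| "U_sum m n j (c # cs) = c * U m n j + U_sum m n (Suc j) cs"

fun residue_sum :: "(nat \<Rightarrow> int) \<Rightarrow> nat \<Rightarrow> int list \<Rightarrow> int" where
  "residue_sum r j [] = 0"
| "residue_sum r j (c # cs) = c * r j + residue_sum r (Suc j) cs"

text \<open>\<open>D\<close> is the same combination of the quotients \<open>U m n i div m\<close>;
  multiplied by \<open>n\<close>, these are the next terms of \<open>U\<close>. So crossing
  \<open>a^-1\<close> raises all indices by one.\<close>

lemma U_sum_split:
  assumes "\<forall>i<j + length cs. U m n i mod m = r i"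
  shows "\<exists>D. U_sum m n j cs = residue_sum r j cs + m * D \<and> U_sum m n (Suc j) cs = n * D"
  using assms
proof (induction cs arbitrary: j)
  case (Cons c cs)
  obtain D where D: "U_sum m n (Suc j) cs = residue_sum r (Suc j) cs + m * D"
      "U_sum m n (Suc (Suc j)) cs = n * D"
    using Cons.IH[of "Suc j"] Cons.prems by auto
  have "U m n j = r j + m * (U m n j div m)" using Cons.prems by (metis add.commute
        mult_div_mod_eq less_add_same_cancel1 length_greater_0_conv list.distinct(1))
  then have "U_sum m n j (c # cs) = c * (r j + m * (U m n j div m)) + residue_sum r (Suc j) cs + m * D"
    using D by simp
  then show ?case using D by (intro exI[of _ "c * (U m n j div m) + D"]) (simp add: algebra_simps)
qed (auto intro: exI[of _ 0])

text \<open>The constant that appears when such a power of \<open>b\<close> crosses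
  \<open>a\<close>: the sum is \<open>n * t\<close>, and \<open>m * t\<close> is this constant plus
  the sum with all indices lowered by one.\<close>

definition low_part :: "int \<Rightarrow> (nat \<Rightarrow> int) \<Rightarrow> int list \<Rightarrow> int" where
  "low_part m r cs = (case cs of [] \<Rightarrow> 0 | c # cs' \<Rightarrow> m * c - residue_sum r 0 cs')"

lemma U_sum_divide:
  assumes "\<forall>i<length cs. U m n i mod m = r i"
  shows "\<exists>t. U_sum m n 0 cs = n * t \<and> m * t = low_part m r cs + U_sum m n 0 (tl cs)"
proof (cases cs)
  case (Cons c cs')
  obtain D where "U_sum m n 0 cs' = residue_sum r 0 cs' + m * D" "U_sum m n (Suc 0) cs' = n * D"
    using U_sum_split[of 0 cs' m n r] assms Cons by auto
  \<comment> \<open>The first coefficient multiplies \<open>U m n 0 = n\<close>, so it joins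
    \<open>D\<close> in the quotient by \<open>n\<close>.\<close>
  then show ?thesis
    by (intro exI[of _ "c + D"]) (simp add: Cons low_part_def algebra_simps)
qed (auto simp: low_part_def intro: exI[of _ 0])

abbreviation residues_match :: "int \<Rightarrow> (nat \<Rightarrow> int) \<Rightarrow> nat \<Rightarrow> int \<Rightarrow> bool" where
  "residues_match m r K n \<equiv> (\<forall>i<K. U m n i mod m = r i)"

text \<open>The sum is a multiple of \<open>n\<close>, so it cannot cancel
  \<open>k \<noteq> 0\<close> when \<open>|n| > |k|\<close>. For \<open>k = 0\<close> it is
  \<open>n * t\<close>, and \<open>m * t\<close> is a combination with one coefficient fewer, to
  which the induction hypothesis applies.\<close>

lemma U_sum_eq_0_eventually:
  assumes "m \<noteq> 0"
  shows "\<exists>V B. \<forall>n. \<bar>n\<bar> \<ge> B \<longrightarrow> residues_match m r (length cs) n \<longrightarrow> (k + U_sum m n 0 cs = 0 \<longleftrightarrow> V)"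
proof (induction cs arbitrary: k)
  case Nil
  show ?case by auto
next
  case (Cons c cs)
  let ?cs = "c # cs"
  show ?case
  proof (cases "k = 0")
    case False
    have "k + U_sum m n 0 ?cs \<noteq> 0" if n: "\<bar>n\<bar> \<ge> \<bar>k\<bar> + 1" "residues_match m r (length ?cs) n" for n
    proof
      assume 0: "k + U_sum m n 0 ?cs = 0"
      obtain t where "U_sum m n 0 ?cs = n * t" using U_sum_divide[OF n(2)] by auto
      then have "k = n * (- t)" using 0 by simp
      then have "n dvd k" by (rule dvdI)
      then show False using n(1) dvd_imp_le_int[OF False] by fastforce
    qed
    then show ?thesis by blast
  next
    case True
    obtain V B where V: "\<forall>n. \<bar>n\<bar> \<ge> B \<longrightarrow> residues_match m r (length cs) n \<longrightarrow>
        (low_part m r ?cs + U_sum m n 0 cs = 0 \<longleftrightarrow> V)"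
      using Cons[of "low_part m r ?cs"] by (elim exE) (rule that)
    have "k + U_sum m n 0 ?cs = 0 \<longleftrightarrow> V"
      if n: "\<bar>n\<bar> \<ge> max B 1" "residues_match m r (length ?cs) n" for n
    proof -
      obtain t where t: "U_sum m n 0 ?cs = n * t" "m * t = low_part m r ?cs + U_sum m n 0 cs"
        using U_sum_divide[OF n(2)] by auto
      have "n \<noteq> 0" using n by auto
      then have "k + U_sum m n 0 ?cs = 0 \<longleftrightarrow> m * t = 0" using True t(1) assms by simp
      also have "\<dots> \<longleftrightarrow> V" using V[rule_format, of n] n t(2) by simp
      finally show ?thesis .
    qed
    then show ?thesis by blast
  qed
qed

section \<open>Reduction depends only on residues\<close>

text \<open>The reduction is carried out symbolically, with \<open>st\<close>, \<open>k\<close> and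
  \<open>cs\<close> common to all large \<open>n\<close> with the given residues. Only
  \<open>a^-1\<close> lengthens \<open>cs\<close>, by one coefficient; \<open>a\<close> drops
  one.\<close>

lemma run_eventually:
  assumes "m \<noteq> 0"
  shows "\<exists>st k cs B. length cs \<le> count_list w (GA, True) \<and>
    (\<forall>n. n \<noteq> 0 \<longrightarrow> \<bar>n\<bar> \<ge> B \<longrightarrow> residues_match m r (count_list w (GA, True)) n \<longrightarrow>
      run m n w ([], 0) = (st, k + U_sum m n 0 cs))"
proof (induction w rule: rev_induct)
  case Nil
  show ?case by (rule exI[of _ "[]"], rule exI[of _ 0], rule exI[of _ "[]"]) simp
next
  case (snoc x w)
  let ?K = "count_list w (GA, True)" and ?K' = "count_list (w @ [x]) (GA, True)"
  from snoc obtain st k cs B where cs: "length cs \<le> ?K"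
    and run: "\<And>n. n \<noteq> 0 \<Longrightarrow> \<bar>n\<bar> \<ge> B \<Longrightarrow> residues_match m r ?K n \<Longrightarrow>
      run m n w ([], 0) = (st, k + U_sum m n 0 cs)"
    by metis
  consider e where "x = (GB, e)" | "x = (GA, False)" | "x = (GA, True)"
    by (metis gen.exhaust surj_pair)
  then show ?case
  proof cases
    case 1
    have "length cs \<le> ?K'" using cs by simp
    moreover have "run m n (w @ [x]) ([], 0) = (st, (k + (if e then - 1 else 1)) + U_sum m n 0 cs)"
      if "n \<noteq> 0" "\<bar>n\<bar> \<ge> B" "residues_match m r ?K' n" for n
      using run[of n] that 1 by simp
    ultimately show ?thesis by blast
  next
    case 2
    let ?P = "k = 0 \<and> pinch False st"
    \<comment> \<open>For \<open>|n| > 2|k|\<close> the least remainder of \<open>k + n * t\<close>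
      modulo \<open>n\<close> is \<open>k\<close>, so the choice between push and pop does not
      involve \<open>n\<close>.\<close>
    define st' k' where "st' = (if ?P then tl st else (False, k) # st)"
      and "k' = (if ?P then snd (hd st) else 0) + low_part m r cs"
    have "length (tl cs) \<le> ?K'" using cs by simp
    moreover have "run m n (w @ [x]) ([], 0) = (st', k' + U_sum m n 0 (tl cs))"
      if n: "n \<noteq> 0" "\<bar>n\<bar> \<ge> max B (2 * \<bar>k\<bar> + 1)" "residues_match m r ?K' n" for n
    proof -
      have n': "residues_match m r ?K n" using n(3) by simp
      obtain t where t: "U_sum m n 0 cs = n * t" "m * t = low_part m r cs + U_sum m n 0 (tl cs)"
        using U_sum_divide[of cs m n r] n' cs by auto
      have k: "crem n k = k" using n by (intro crem_small) simp
      have "run m n w ([], 0) = (st, k + n * t)" using run n n' t by simp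
      then show ?thesis
        using k t(2) cquo_eq[OF n(1) k, of t] 2
        by (auto simp: Let_def edge_index_def st'_def k'_def)
    qed
    ultimately show ?thesis by blast
  next
    case 3
    \<comment> \<open>The exponent is \<open>s + m * D\<close>. Its remainder modulo
      \<open>m\<close> is that of \<open>s\<close>, and \<open>n\<close> times its quotient is
      \<open>cquo m s * U m n 0\<close> plus the shifted sum; hence the new head of
      \<open>cs\<close>.\<close>
    define s where "s = k + residue_sum r 0 cs"
    let ?P = "crem m s = 0 \<and> pinch True st"
    define st' k' where "st' = (if ?P then tl st else (True, crem m s) # st)"
      and "k' = (if ?P then snd (hd st) else 0)"
    have "length (cquo m s # cs) \<le> ?K'" using cs 3 by simp
    moreover have "run m n (w @ [x]) ([], 0) = (st', k' + U_sum m n 0 (cquo m s # cs))"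
      if n: "n \<noteq> 0" "\<bar>n\<bar> \<ge> B" "residues_match m r ?K' n" for n
    proof -
      have n': "residues_match m r ?K n" using n(3) by simp
      obtain D where D: "U_sum m n 0 cs = residue_sum r 0 cs + m * D" "U_sum m n (Suc 0) cs = n * D"
        using U_sum_split[of 0 cs m n r] n' cs by auto
      have "run m n w ([], 0) = (st, s + m * D)" using run n n' D by (simp add: s_def)
      then show ?thesis
        using D(2) cquo_add_mult[OF assms, of s D] 3
        by (auto simp: Let_def edge_index_def st'_def k'_def distrib_left)
    qed
    ultimately show ?thesis by blast
  qed
qed

text \<open>The final state is trivial iff \<open>st\<close> is empty, which does not involve
  \<open>n\<close>, and the exponent vanishes, which \<open>U_sum_eq_0_eventually\<close>
  settles.\<close>

lemma BS_trivial_eventually: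
  assumes "m \<noteq> 0"
  shows "\<exists>V B. \<forall>n. n \<noteq> 0 \<longrightarrow> \<bar>n\<bar> \<ge> B \<longrightarrow> residues_match m r (count_list w (GA, True)) n \<longrightarrow>
      (pres_equiv {BS_rel m n} w [] \<longleftrightarrow> V)"
proof -
  let ?K = "count_list w (GA, True)"
  obtain st k cs B where cs: "length cs \<le> ?K"
    and run: "\<And>n. n \<noteq> 0 \<Longrightarrow> \<bar>n\<bar> \<ge> B \<Longrightarrow> residues_match m r ?K n \<Longrightarrow>
      run m n w ([], 0) = (st, k + U_sum m n 0 cs)"
    using run_eventually[OF assms] by metis
  obtain V B' where V: "\<And>n. \<bar>n\<bar> \<ge> B' \<Longrightarrow> residues_match m r (length cs) n \<Longrightarrow> (k + U_sum m n 0 cs = 0 \<longleftrightarrow> V)"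
    using U_sum_eq_0_eventually[OF assms] by metis
  have "pres_equiv {BS_rel m n} w [] \<longleftrightarrow> st = [] \<and> V"
    if "n \<noteq> 0" "\<bar>n\<bar> \<ge> max B B'" "residues_match m r ?K n" for n
    using that run[of n] V[of n] cs BS_trivial_iff_run[OF assms that(1), of w] by auto
  then show ?thesis by blast
qed

section \<open>Exponent sums and free reduction\<close>

text \<open>The relator has exponent sum 0 in \<open>a\<close>; the invariance is written without
  subtraction. In a trivial word at most half of the letters are then \<open>a^-1\<close>, whence
  the length \<open>2 * h\<close>.\<close>

lemma count_GA_pres_equiv:
  assumes "pres_equiv {BS_rel p q} u v"
  shows "count_list u (GA, False) + count_list v (GA, True) = count_list v (GA, False) + count_list u (GA, True)"
proof -
  have b: "count_list (gen_pow GB k) (GA, e) = 0" for k e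
    by (auto simp: gen_pow_def count_list_0_iff)
  have step: "count_list u (GA, False) + count_list v (GA, True) = count_list v (GA, False) + count_list u (GA, True)"
    if "pres_step {BS_rel p q} u v" for u v
    using that
  proof cases
    case (1 s u' v')
    then show ?thesis by (simp add: BS_rel_def b)
  next
    case (2 s u' v')
    have "inv_word (BS_rel p q) = gen_pow GB q @ [(GA, False)] @ gen_pow GB (- p) @ [(GA, True)]"
      using inv_word_gen_pow[of GB p] inv_word_gen_pow[of GB "- q"]
      by (simp add: BS_rel_def inv_word_def inv_letter_def)
    then show ?thesis using 2 by (simp add: b)
  next
    case (3 u' v' x)
    then show ?thesis by (cases x) (auto simp: inv_letter_def)
  qed
  show ?thesis using assms unfolding pres_equiv_def
    by (induction rule: equivclp_induct) (auto dest: step)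
qed

lemma count_list_add_le: "x \<noteq> y \<Longrightarrow> count_list w x + count_list w y \<le> length w"
  by (induction w) auto

text \<open>The marked groups consist of reduced words, while test words may fail to be reduced.
  Deleting a cancelling pair shortens the word and keeps its class for every
  \<open>R\<close>.\<close>

lemma free_reduction:
  "\<exists>w'. reduced w' \<and> length w' \<le> length w \<and> (\<forall>R. pres_equiv R w w')"
proof (induction "length w" arbitrary: w rule: less_induct)
  case less
  show ?case
  proof (cases "reduced w")
    case False
    have "\<exists>u x v. w = u @ [x, inv_letter x] @ v" using False
    proof (induction w rule: reduced.induct)
      case (3 x y w)
      then show ?case
        by (metis append_Cons append_Nil reduced.simps(3))
    qed auto
    then obtain u x v where w: "w = u @ [x, inv_letter x] @ v" by blast
    obtain w' where w': "reduced w'" "length w' \<le> length (u @ v)" "\<forall>R. pres_equiv R (u @ v) w'"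
      using less[of "u @ v"] w by auto
    have "pres_equiv R w (u @ v)" for R
      using pres_equiv_context[OF pres_equiv_cancel[of R x], of u v] w by simp
    then have "\<forall>R. pres_equiv R w w'" using w'(3) pres_equiv_trans by blast
    then show ?thesis using w' w by (intro exI[of _ w']) simp
  qed auto
qed

section \<open>Words detecting a residue\<close>

text \<open>A word for \<open>b^(U_i)\<close> whose length does not grow with \<open>n\<close>,
  valid when the residues of index below \<open>i\<close> are those in \<open>r\<close>.\<close>

fun U_word :: "int \<Rightarrow> (nat \<Rightarrow> int) \<Rightarrow> nat \<Rightarrow> word" where
  "U_word m r 0 = [(GA, False)] @ gen_pow GB m @ [(GA, True)]"
| "U_word m r (Suc i) = [(GA, False)] @ (U_word m r i @ gen_pow GB (- r i)) @ [(GA, True)]"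

lemma BS_conj_pow:
  assumes "pres_equiv {BS_rel m n} u (gen_pow GB (m * t))"
  shows "pres_equiv {BS_rel m n} ([(GA, False)] @ u @ [(GA, True)]) (gen_pow GB (n * t))"
proof -
  let ?eq = "pres_equiv {BS_rel m n}"
  have "?eq ([(GA, False)] @ u @ [(GA, True)]) ([(GA, False)] @ gen_pow GB (m * t) @ [(GA, True)])"
    by (intro pres_equiv_context assms)
  also have "?eq \<dots> (gen_pow GB (n * t) @ [(GA, False), (GA, True)])"
    using pres_equiv_context[OF pres_equiv_sym[OF BS_conj[of m n t]], of "[]" "[(GA, True)]"] by simp
  also have "?eq \<dots> (gen_pow GB (n * t) @ [])"
    using pres_equiv_cancel[of _ "(GA, False)"]
    by (intro pres_equiv_append pres_equiv_refl) (simp add: inv_letter_def)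
  finally show ?thesis by simp
qed

lemma U_word_equiv:
  "residues_match m r i n \<Longrightarrow> pres_equiv {BS_rel m n} (U_word m r i) (gen_pow GB (U m n i))"
proof (induction i)
  case 0
  show ?case using BS_conj_pow[of m n "gen_pow GB m" 1] by simp
next
  case (Suc i)
  have "U m n i + - r i = m * (U m n i div m)"
    using Suc.prems by (metis add.commute add_diff_cancel_left' diff_conv_add_uminus lessI mod_mult_div_eq)
  moreover have "pres_equiv {BS_rel m n} (U_word m r i @ gen_pow GB (- r i)) (gen_pow GB (U m n i + - r i))"
    using Suc by (intro pres_equiv_trans[OF pres_equiv_append gen_pow_add]) auto
  ultimately show ?case using BS_conj_pow[of m n "U_word m r i @ gen_pow GB (- r i)"] by simp
qed

lemma length_gen_pow: "length (gen_pow g k) = nat \<bar>k\<bar>"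
  by (simp add: gen_pow_def)

lemma length_U_word:
  assumes "m \<noteq> 0" and "\<forall>j<i. \<bar>r j\<bar> < \<bar>m\<bar>"
  shows "length (U_word m r i) \<le> 2 + nat \<bar>m\<bar> + i * (nat \<bar>m\<bar> + 1)"
  using assms(2)
proof (induction i)
  case (Suc i)
  \<comment> \<open>Each step adds \<open>a\<close>, \<open>a^-1\<close> and at most
    \<open>|m| - 1\<close> letters \<open>b\<close>.\<close>
  then have "length (U_word m r i) \<le> 2 + nat \<bar>m\<bar> + i * (nat \<bar>m\<bar> + 1)" "nat \<bar>r i\<bar> + 1 \<le> nat \<bar>m\<bar>"
    using assms(1) by (auto simp: nat_less_iff Suc_le_eq)
  then show ?case by (simp add: length_gen_pow)
qed (simp add: length_gen_pow)

text \<open>A commutator with \<open>b\<close>. If \<open>r\<close> is right below \<open>j\<close>,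
  then for \<open>|n| \<ge> 2\<close> it is trivial exactly when \<open>r j\<close> is right modulo
  \<open>m\<close>.\<close>

definition test_word :: "int \<Rightarrow> (nat \<Rightarrow> int) \<Rightarrow> nat \<Rightarrow> word" where
  "test_word m r j = U_word m r (Suc j) @ gen_pow GB 1 @ inv_word (U_word m r (Suc j)) @ gen_pow GB (- 1)"

lemma length_test_word:
  assumes "m \<noteq> 0" and "\<forall>i\<le>j. \<bar>r i\<bar> < \<bar>m\<bar>"
  shows "length (test_word m r j) \<le> 2 * (nat \<bar>m\<bar> + 1) * Suc j + 2 * nat \<bar>m\<bar> + 6"
proof -
  have "length (test_word m r j) = 2 * length (U_word m r (Suc j)) + 2"
    by (simp only: test_word_def length_append inv_word_def length_rev length_map length_gen_pow)
  then show ?thesis using length_U_word[of m "Suc j" r] assms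
    by (simp add: less_Suc_eq_le algebra_simps del: U_word.simps)
qed

lemma test_word_trivial:
  assumes "residues_match m r (Suc j) n"
  shows "pres_equiv {BS_rel m n} (test_word m r j) []"
proof -
  let ?eq = "pres_equiv {BS_rel m n}" and ?b = "gen_pow GB" and ?u = "U m n (Suc j)"
  have u: "?eq (U_word m r (Suc j)) (?b ?u)" by (rule U_word_equiv[OF assms])
  have u': "?eq (inv_word (U_word m r (Suc j))) (?b (- ?u))"
    using pres_equiv_inv_cong[OF u] by (simp only: inv_word_gen_pow)
  have "?eq (test_word m r j) (?b ?u @ ?b 1 @ ?b (- ?u) @ ?b (- 1))"
    unfolding test_word_def by (intro pres_equiv_append u u' pres_equiv_refl)
  also have "?eq \<dots> (?b (?u + 1) @ ?b (- ?u - 1))"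
    using pres_equiv_append[OF gen_pow_add[of "{BS_rel m n}" GB ?u 1] gen_pow_add[of _ GB "- ?u" "- 1"]]
    by (simp del: U.simps)
  also have "?eq \<dots> (?b ((?u + 1) + (- ?u - 1)))" by (rule gen_pow_add)
  finally show ?thesis by simp
qed

text \<open>The test word is the commutator of \<open>v = a b^s a^-1\<close> and \<open>b\<close>.
  Nothing cancels at the first \<open>a^-1\<close> since \<open>m\<close> does not divide
  \<open>s\<close>, nor at the next \<open>a\<close> since \<open>n\<close> does not divide 1. The
  stack then has three entries, and the one remaining \<open>a^-1\<close> removes at most
  one.\<close>

lemma test_word_nontrivial:
  assumes "m \<noteq> 0" "\<bar>n\<bar> \<ge> 2" and "residues_match m r j n" and "\<not> m dvd U m n j - r j"
  shows "\<not> pres_equiv {BS_rel m n} (test_word m r j) []"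
proof -
  let ?eq = "pres_equiv {BS_rel m n}" and ?b = "gen_pow GB" and ?s = "U m n j - r j"
  define v where "v = [(GA, False)] @ ?b ?s @ [(GA, True)]"
  have "?eq (U_word m r j @ gen_pow GB (- r j)) (?b ?s)"
    using pres_equiv_trans[OF pres_equiv_append[OF U_word_equiv[OF assms(3)] pres_equiv_refl] gen_pow_add,
        of "- r j"] by simp
  then have u: "?eq (U_word m r (Suc j)) v"
    unfolding v_def U_word.simps(2) by (rule pres_equiv_context)
  have eq: "?eq (test_word m r j) (v @ ?b 1 @ inv_word v @ ?b (- 1))"
    unfolding test_word_def by (intro pres_equiv_append u pres_equiv_inv_cong pres_equiv_refl)
  have n: "n \<noteq> 0" using assms by auto
  \<comment> \<open>After the first \<open>a^-1\<close> the exponent is a multiple of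
    \<open>n\<close>, and the middle letter \<open>b\<close> adds 1.\<close>
  have "\<not> n dvd 1" using assms(2) by auto
  then have n1: "crem n (n * t + 1) \<noteq> 0" for t
    using n by (simp add: crem_eq_0_iff dvd_add_right_iff)
  have m1: "crem m ?s \<noteq> 0" using assms by (simp add: crem_eq_0_iff)
  have 0: "crem n 0 = 0" "cquo n 0 = 0" using n crem_eq_0_iff[of n 0] by (auto simp: cquo_def)
  have "inv_word v = [(GA, False)] @ ?b (- ?s) @ [(GA, True)]"
    by (simp only: v_def inv_word_append inv_word_gen_pow) (simp add: inv_word_def inv_letter_def)
  then have "run m n (v @ ?b 1 @ inv_word v @ ?b (- 1)) ([], 0) \<noteq> ([], 0)"
    using n1 m1 by (simp add: v_def edge_index_def Let_def 0)
  then show ?thesis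
    using run_pres_equiv[OF assms(1) n eq, of "([], 0)"] BS_trivial_iff_run[OF assms(1) n] by simp
qed

section \<open>The limit groups\<close>

lemma Zm_mod:
  assumes "\<xi> \<in> Zm m" and "k \<le> l"
  shows "\<xi> l mod \<bar>m\<bar> ^ k = \<xi> k"
  using assms(2)
proof (induction l rule: dec_induct)
  case base
  show ?case using assms(1) by (simp add: Zm_def)
next
  case (step l)
  have "\<xi> (Suc l) mod \<bar>m\<bar> ^ k = \<xi> (Suc l) mod \<bar>m\<bar> ^ l mod \<bar>m\<bar> ^ k"
    using step by (simp add: mod_mod_cancel le_imp_power_dvd)
  then show ?case using step assms(1) by (simp add: Zm_def)
qed

lemma zm_of_int_in_Zm: "m \<noteq> 0 \<Longrightarrow> zm_of_int m c \<in> Zm m"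
  by (auto simp: Zm_def zm_of_int_def mod_mod_cancel)

text \<open>Adding \<open>|m| ^ n * n\<close> keeps the residues at levels up to \<open>n\<close>
  and forces growth, even for \<open>|m| = 1\<close>. The existence keeps the quantifier in
  \<open>BSbar\<close> from being vacuous.\<close>

lemma Zm_sequence:
  assumes "m \<noteq> 0" "\<xi> \<in> Zm m"
  shows "\<exists>xs. (\<forall>B. eventually (\<lambda>n. \<bar>xs n\<bar> \<ge> B) sequentially) \<and> zm_tendsto m xs \<xi>"
proof (intro exI conjI allI)
  define xs where "xs n = \<xi> n + \<bar>m\<bar> ^ n * int n" for n
  have "xs n mod \<bar>m\<bar> ^ k = \<xi> k" if "k \<le> n" for k n
  proof -
    have "\<bar>m\<bar> ^ k dvd \<bar>m\<bar> ^ n * int n" using that by (simp add: le_imp_power_dvd)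
    then have "xs n mod \<bar>m\<bar> ^ k = \<xi> n mod \<bar>m\<bar> ^ k" 
      unfolding xs_def by (auto elim!: dvdE)
    then show ?thesis using Zm_mod[OF assms(2) that] by simp
  qed
  then show "zm_tendsto m xs \<xi>" unfolding zm_tendsto_def eventually_sequentially by blast
  fix B
  have "\<bar>xs n\<bar> \<ge> int n" for n
  proof -
    have "\<xi> n \<ge> 0" using assms(2) by (simp add: Zm_def)
    moreover have "1 * int n \<le> \<bar>m\<bar> ^ n * int n"
      using assms(1) by (intro mult_right_mono one_le_power) auto
    ultimately show ?thesis unfolding xs_def by simp
  qed
  then have "B \<le> \<bar>xs n\<bar>" if "n \<ge> nat B" for n
    using that by (meson nat_le_iff order_trans)
  then show "eventually (\<lambda>n. \<bar>xs n\<bar> \<ge> B) sequentially"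
    unfolding eventually_sequentially by blast
qed

text \<open>Every admissible sequence eventually meets both conditions on \<open>n\<close>; for the
  converse, \<open>Zm_sequence\<close> supplies one sequence along which membership forces
  \<open>V\<close>.\<close>

lemma BSbar_iff:
  assumes "m \<noteq> 0" "\<xi> \<in> Zm m" "reduced w"
    and V: "\<And>n. \<bar>n\<bar> \<ge> B \<Longrightarrow> n mod \<bar>m\<bar> ^ K = \<xi> K \<Longrightarrow> pres_equiv {BS_rel m n} w [] \<longleftrightarrow> V"
  shows "w \<in> BSbar m \<xi> \<longleftrightarrow> V"
proof -
  have ev: "eventually (\<lambda>n. w \<in> BS m (xs n) \<longleftrightarrow> V) sequentially"
    if "\<forall>B. eventually (\<lambda>n. \<bar>xs n\<bar> \<ge> B) sequentially" "zm_tendsto m xs \<xi>" for xs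
  proof -
    have "eventually (\<lambda>n. \<bar>xs n\<bar> \<ge> B) sequentially" "eventually (\<lambda>n. xs n mod \<bar>m\<bar> ^ K = \<xi> K) sequentially"
      using that by (auto simp: zm_tendsto_def)
    then show ?thesis
      by eventually_elim (use V assms(3) in \<open>auto simp: BS_def normal_closure_def\<close>)
  qed
  obtain xs where xs: "\<forall>B. eventually (\<lambda>n. \<bar>xs n\<bar> \<ge> B) sequentially" "zm_tendsto m xs \<xi>"
    using Zm_sequence[OF assms(1,2)] by blast
  show ?thesis
  proof
    assume "w \<in> BSbar m \<xi>"
    then have "eventually (\<lambda>n. w \<in> BS m (xs n)) sequentially" using xs by (simp add: BSbar_def)
    with ev[OF xs] have "eventually (\<lambda>n. V) sequentially" by eventually_elim simp
    then show V by simp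
  next
    assume V
    then show "w \<in> BSbar m \<xi>" using ev assms(3) by (simp add: BSbar_def)
  qed
qed

section \<open>gcd and congruence at a finite level\<close>

text \<open>The two inclusions of ideals are read at level \<open>h\<close>, modulo
  \<open>|m| ^ h\<close>, which is a multiple of \<open>m\<close> since \<open>h \<ge> 1\<close>.
  That \<open>d\<close> lies in the left ideal gives \<open>gcd m n dvd d\<close>; that
  \<open>\<xi>\<close> lies in the right one gives \<open>d dvd n\<close>.\<close>

lemma gcd_of_zm_gcd_is:
  assumes "m \<noteq> 0" "h \<ge> 1" "\<xi> \<in> Zm m" "zm_gcd_is m \<xi> d" "n mod \<bar>m\<bar> ^ h = \<xi> h"
  shows "gcd m n = d"
proof -
  let ?M = "\<bar>m\<bar> ^ h"
  have "\<bar>m\<bar> dvd ?M" using assms(2) by (intro dvd_power) simp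
  then have mM: "m dvd ?M" by (simp only: abs_dvd_iff)
  have d: "d > 0" "d dvd m" and eq:
    "{zm_add m (zm_mul m (zm_of_int m m) u) (zm_mul m \<xi> v) | u v. u \<in> Zm m \<and> v \<in> Zm m}
       = {zm_mul m (zm_of_int m d) w | w. w \<in> Zm m}"
    using assms(4) by (auto simp: zm_gcd_is_def)
  note i = zm_of_int_in_Zm[OF assms(1)]
  have "zm_mul m (zm_of_int m d) (zm_of_int m 1) \<in> {zm_mul m (zm_of_int m d) w | w. w \<in> Zm m}"
    using i by blast
  then obtain u v where "zm_mul m (zm_of_int m d) (zm_of_int m 1) =
      zm_add m (zm_mul m (zm_of_int m m) u) (zm_mul m \<xi> v)" unfolding eq[symmetric] by blast
  then have "zm_mul m (zm_of_int m d) (zm_of_int m 1) h =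
      zm_add m (zm_mul m (zm_of_int m m) u) (zm_mul m \<xi> v) h" by simp
  then have "d mod ?M = (m * u h + n * v h) mod ?M"
    unfolding zm_mul_def zm_add_def zm_of_int_def assms(5)[symmetric] by (simp add: mod_simps)
  then have "?M dvd d - (m * u h + n * v h)" by (simp add: mod_eq_dvd_iff)
  then have "gcd m n dvd d - (m * u h + n * v h)" using mM by (meson dvd_trans gcd_dvd1)
  moreover have "gcd m n dvd m * u h + n * v h" by simp
  ultimately have 1: "gcd m n dvd d" by (metis dvd_add diff_add_cancel)
  have "zm_add m (zm_mul m (zm_of_int m m) (zm_of_int m 0)) (zm_mul m \<xi> (zm_of_int m 1)) \<in>
      {zm_add m (zm_mul m (zm_of_int m m) u) (zm_mul m \<xi> v) | u v. u \<in> Zm m \<and> v \<in> Zm m}"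
    using i by blast
  then obtain w where "zm_add m (zm_mul m (zm_of_int m m) (zm_of_int m 0)) (zm_mul m \<xi> (zm_of_int m 1)) =
      zm_mul m (zm_of_int m d) w" unfolding eq by blast
  then have "zm_add m (zm_mul m (zm_of_int m m) (zm_of_int m 0)) (zm_mul m \<xi> (zm_of_int m 1)) h =
      zm_mul m (zm_of_int m d) w h" by simp
  then have "n mod ?M = (d * w h) mod ?M"
    unfolding zm_mul_def zm_add_def zm_of_int_def assms(5)[symmetric] by (simp add: mod_simps)
  then have "?M dvd n - d * w h" by (simp add: mod_eq_dvd_iff)
  then have "d dvd n - d * w h" using mM d(2) by (meson dvd_trans)
  then have "d dvd n" by (metis dvd_add diff_add_cancel dvd_triv_left)
  then show ?thesis using 1 d by (simp add: gcd_greatest zdvd_antisym_nonneg)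
qed

text \<open>Level \<open>h\<close> decides because \<open>N\<close> divides \<open>|m| ^ h\<close>.
  For the quotient \<open>w\<close>, dividing by \<open>N\<close> costs at most \<open>h\<close>
  levels of precision, so its level \<open>k\<close> is taken from level
  \<open>k + h\<close>.\<close>

lemma zm_cong_iff:
  assumes "m \<noteq> 0" "\<xi> \<in> Zm m" "\<xi>' \<in> Zm m" and N: "N dvd \<bar>m\<bar> ^ h"
  shows "zm_cong m N \<xi> \<xi>' \<longleftrightarrow> N dvd \<xi> h - \<xi>' h"
proof
  assume "zm_cong m N \<xi> \<xi>'"
  then obtain w where "\<xi> = zm_add m \<xi>' (zm_mul m (zm_of_int m N) w)" by (auto simp: zm_cong_def)
  then have "\<xi> h = (\<xi>' h + N * w h) mod \<bar>m\<bar> ^ h"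
    by (simp add: zm_add_def zm_mul_def zm_of_int_def mod_simps)
  then have "\<bar>m\<bar> ^ h dvd \<xi> h - (\<xi>' h + N * w h)"
    by (metis mod_eq_dvd_iff mod_mod_trivial)
  then have "N dvd \<xi> h - (\<xi>' h + N * w h)" using N by (rule dvd_trans[rotated])
  then have "N dvd \<xi> h - (\<xi>' h + N * w h) + N * w h" by (rule dvd_add) simp
  then show "N dvd \<xi> h - \<xi>' h" by simp
next
  assume dvd: "N dvd \<xi> h - \<xi>' h"
  let ?M = "\<lambda>k. \<bar>m\<bar> ^ k"
  obtain M' where M': "?M h = N * M'" using N by blast
  have N0: "N \<noteq> 0" using M' assms(1) by auto
  define \<delta> where "\<delta> k = (\<xi> (k + h) - \<xi>' (k + h)) div N" for k
  have \<delta>: "\<xi> (k + h) - \<xi>' (k + h) = N * \<delta> k" for k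
  proof -
    have "?M h dvd \<xi> (k + h) - \<xi> h" "?M h dvd \<xi>' (k + h) - \<xi>' h"
      using Zm_mod[OF assms(2), of h "k + h"] Zm_mod[OF assms(3), of h "k + h"]
      by (metis dvd_minus_mod le_add2)+
    then have "N dvd \<xi> (k + h) - \<xi> h" "N dvd \<xi>' (k + h) - \<xi>' h" using N dvd_trans by blast+
    from dvd_add[OF dvd_diff[OF this] dvd]
    show ?thesis by (simp add: \<delta>_def)
  qed
  define w where "w k = \<delta> k mod ?M k" for k
  have "\<delta> (Suc k) mod ?M k = \<delta> k mod ?M k" for k
  proof -
    have "?M (k + h) dvd \<xi> (Suc k + h) - \<xi> (k + h)" "?M (k + h) dvd \<xi>' (Suc k + h) - \<xi>' (k + h)"
      using Zm_mod[OF assms(2), of "k + h" "Suc k + h"] Zm_mod[OF assms(3), of "k + h" "Suc k + h"]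
      by (metis dvd_minus_mod le_add2 add_Suc le_SucI order.refl)+
    then have "?M (k + h) dvd (\<xi> (Suc k + h) - \<xi> (k + h)) - (\<xi>' (Suc k + h) - \<xi>' (k + h))"
      by (rule dvd_diff)
    also have "\<dots> = N * (\<delta> (Suc k) - \<delta> k)" using \<delta>[of k] \<delta>[of "Suc k"] by (simp add: algebra_simps)
    \<comment> \<open>Here \<open>|m| ^ (k + h)\<close> is written as
      \<open>N * (|m| ^ k * M')\<close>; cancelling \<open>N\<close> makes the quotients compatible
      modulo \<open>|m| ^ k\<close>.\<close>
    finally have "N * (?M k * M') dvd N * (\<delta> (Suc k) - \<delta> k)" by (simp add: power_add M' mult_ac)
    then have "?M k dvd \<delta> (Suc k) - \<delta> k" using N0 by (simp add: dvd_mult_left)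
    then show ?thesis by (simp add: mod_eq_dvd_iff)
  qed
  then have w: "w \<in> Zm m"
    using assms(1) by (auto simp: Zm_def w_def mod_mod_cancel)
  have "\<xi> k = (\<xi>' k + N * w k) mod ?M k" for k
  proof -
    have "\<xi> k = \<xi> (k + h) mod ?M k" "\<xi>' k = \<xi>' (k + h) mod ?M k"
      using Zm_mod[OF assms(2), of k "k + h"] Zm_mod[OF assms(3), of k "k + h"] by auto
    moreover have "\<xi> (k + h) = \<xi>' (k + h) + N * \<delta> k" using \<delta>[of k] by simp
    moreover have "(a + N * (\<delta> k mod ?M k)) mod ?M k = (a + N * \<delta> k) mod ?M k" for a
      by (metis mod_add_right_eq mod_mult_right_eq)
    ultimately show ?thesis by (simp add: w_def mod_simps)
  qed
  then have "\<xi> = zm_add m \<xi>' (zm_mul m (zm_of_int m N) w)"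
    by (intro ext) (simp add: zm_add_def zm_mul_def zm_of_int_def mod_simps)
  then show "zm_cong m N \<xi> \<xi>'" using w by (auto simp: zm_cong_def)
qed

section \<open>The two implications\<close>

theorem theorem6p1:
  fixes m :: int and h :: nat and \<xi> \<xi>' :: "nat \<Rightarrow> int" and d :: int
  assumes "m \<noteq> 0" and "h \<ge> 1"
    and "\<xi> \<in> Zm m" and "\<xi>' \<in> Zm m"
    and "zm_gcd_is m \<xi> d" and "zm_gcd_is m \<xi>' d"
  shows "(same_relations_upto (2 * (nat \<bar>m\<bar> + 1) * h + 2 * nat \<bar>m\<bar> + 6) (BSbar m \<xi>) (BSbar m \<xi>')
            \<longrightarrow> zm_cong m ((m div d) ^ h * d) \<xi> \<xi>')
       \<and> (zm_cong m ((m div d) ^ h * d) \<xi> \<xi>'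
            \<longrightarrow> same_relations_upto (2 * h) (BSbar m \<xi>) (BSbar m \<xi>'))"
proof -
  let ?N = "(m div d) ^ h * d" and ?M = "\<bar>m\<bar> ^ h"
  \<comment> \<open>The integer \<open>\<xi> h\<close> represents all \<open>n\<close> in its class
    modulo \<open>|m| ^ h\<close>: by \<open>match\<close> below, they share the first
    \<open>h\<close> residues.\<close>
  define r where "r = (\<lambda>i. U m (\<xi> h) i mod m)"
  define r' where "r' = (\<lambda>i. U m (\<xi>' h) i mod m)"
  have self: "\<xi> h mod ?M = \<xi> h" "\<xi>' h mod ?M = \<xi>' h" using Zm_mod assms(3,4) by blast+
  have gcd: "gcd m (\<xi> h) = d" "gcd m (\<xi>' h) = d"
    using gcd_of_zm_gcd_is assms self by blast+
  have "d dvd m" using gcd by auto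
  then have md: "m = (m div d) * d" by simp
  \<comment> \<open>\<open>h \<ge> 1\<close> gives \<open>d dvd d ^ h\<close>.\<close>
  have "?N dvd (m div d) ^ h * d ^ h" using assms(2) by (intro mult_dvd_mono dvd_power) auto
  then have NM: "?N dvd ?M" using md by (metis power_mult_distrib dvd_abs_iff power_abs)
  have match: "residues_match m r h n" if "n mod ?M = \<xi> h" for n
  proof -
    have "?M dvd n - \<xi> h" using that by (metis dvd_minus_mod)
    then show ?thesis unfolding r_def
      using U_residues_eq_iff[OF assms(1) gcd(1)] gcd_of_zm_gcd_is[OF assms(1-3,5) that] NM dvd_trans by blast
  qed
  have match': "residues_match m r' h n" if "n mod ?M = \<xi>' h" for n
  proof -
    have "?M dvd n - \<xi>' h" using that by (metis dvd_minus_mod)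
    then show ?thesis unfolding r'_def
      using U_residues_eq_iff[OF assms(1) gcd(2)] gcd_of_zm_gcd_is[OF assms(1,2,4,6) that] NM dvd_trans by blast
  qed
  have cong: "zm_cong m ?N \<xi> \<xi>' \<longleftrightarrow> (\<forall>i<h. r i = r' i)"
    using zm_cong_iff[OF assms(1,3,4) NM] U_residues_eq_iff[OF assms(1) gcd(2,1), of h]
    by (simp add: r_def r'_def)
  have "zm_cong m ?N \<xi> \<xi>'"
    if same: "same_relations_upto (2 * (nat \<bar>m\<bar> + 1) * h + 2 * nat \<bar>m\<bar> + 6) (BSbar m \<xi>) (BSbar m \<xi>')"
  proof (rule ccontr)
    assume "\<not> ?thesis"
    then have ex: "\<exists>j. j < h \<and> r j \<noteq> r' j" using cong by blast
    \<comment> \<open>At the first differing index, \<open>r\<close> is still right below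
      \<open>j\<close> for integers near \<open>\<xi>'\<close>, as
      \<open>test_word_nontrivial\<close> requires.\<close>
    define j where "j = (LEAST j. j < h \<and> r j \<noteq> r' j)"
    have j: "j < h" "r j \<noteq> r' j" using LeastI_ex[OF ex] by (auto simp: j_def)
    have below: "r i = r' i" if "i < j" for i
      using not_less_Least[of i "\<lambda>j. j < h \<and> r j \<noteq> r' j"] that j(1) by (auto simp: j_def)
    obtain w where w: "reduced w" "length w \<le> length (test_word m r j)"
      "\<And>R. pres_equiv R (test_word m r j) w"
      using free_reduction by blast
    have w_iff: "pres_equiv R w [] \<longleftrightarrow> pres_equiv R (test_word m r j) []" for R
      using w(3) pres_equiv_trans pres_equiv_sym by blast
    have "w \<in> BSbar m \<xi> \<longleftrightarrow> True"
    proof (rule BSbar_iff[OF assms(1,3) w(1)])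
      fix n assume "n mod ?M = \<xi> h"
      then have "residues_match m r (Suc j) n" using match j(1) by simp
      then show "pres_equiv {BS_rel m n} w [] \<longleftrightarrow> True" using test_word_trivial w_iff by blast
    qed
    moreover have "w \<in> BSbar m \<xi>' \<longleftrightarrow> False"
    proof (rule BSbar_iff[OF assms(1,4) w(1)])
      fix n assume n: "\<bar>n\<bar> \<ge> 2" "n mod ?M = \<xi>' h"
      have "residues_match m r j n" using match'[OF n(2)] below j(1) by simp
      moreover have "U m n j mod m \<noteq> r j mod m"
        using match'[OF n(2)] j by (simp add: r_def r'_def)
      then have "\<not> m dvd U m n j - r j" by (simp add: mod_eq_dvd_iff)
      ultimately show "pres_equiv {BS_rel m n} w [] \<longleftrightarrow> False"
        using test_word_nontrivial[OF assms(1) n(1)] w_iff by blast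
    qed
    moreover have "length w \<le> 2 * (nat \<bar>m\<bar> + 1) * h + 2 * nat \<bar>m\<bar> + 6"
    proof -
      have "\<forall>i\<le>j. \<bar>r i\<bar> < \<bar>m\<bar>" using abs_mod_less[OF assms(1)] by (simp add: r_def)
      from length_test_word[OF assms(1) this]
      have "length w \<le> 2 * (nat \<bar>m\<bar> + 1) * Suc j + 2 * nat \<bar>m\<bar> + 6" using w(2) by simp
      also have "\<dots> \<le> 2 * (nat \<bar>m\<bar> + 1) * h + 2 * nat \<bar>m\<bar> + 6"
        using j(1) by (intro add_right_mono mult_left_mono) auto
      finally show ?thesis .
    qed
    ultimately show False using same w(1) by (auto simp: same_relations_upto_def)
  qed
  moreover have "same_relations_upto (2 * h) (BSbar m \<xi>) (BSbar m \<xi>')" if "zm_cong m ?N \<xi> \<xi>'"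
    unfolding same_relations_upto_def
  proof (intro allI impI)
    fix w assume w: "reduced w \<and> length w \<le> 2 * h"
    let ?K = "count_list w (GA, True)"
    have rr: "r i = r' i" if "i < h" for i using \<open>zm_cong m ?N \<xi> \<xi>'\<close> cong that by blast
    \<comment> \<open>One \<open>V\<close> serves both limits, because \<open>r\<close> and
      \<open>r'\<close> agree below \<open>h\<close>.\<close>
    have "\<exists>V B. \<forall>n. \<bar>n\<bar> \<ge> B \<longrightarrow> residues_match m r h n \<longrightarrow> (pres_equiv {BS_rel m n} w [] \<longleftrightarrow> V)"
    proof (cases "count_list w (GA, False) = ?K")
      case False
      then have "\<not> pres_equiv {BS_rel m n} w []" for n
        using count_GA_pres_equiv[of m n w "[]"] by auto
      then show ?thesis by blast
    next
      case True
      then have K: "?K \<le> h" using count_list_add_le[of "(GA, False)" "(GA, True)" w] w by simp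
      obtain V B where V: "\<forall>n. n \<noteq> 0 \<longrightarrow> \<bar>n\<bar> \<ge> B \<longrightarrow> residues_match m r ?K n \<longrightarrow>
          (pres_equiv {BS_rel m n} w [] \<longleftrightarrow> V)"
        using BS_trivial_eventually[OF assms(1), of w r] by (elim exE) (rule that)
      \<comment> \<open>The maximum with 1 excludes \<open>n = 0\<close>.\<close>
      have "pres_equiv {BS_rel m n} w [] \<longleftrightarrow> V" if "\<bar>n\<bar> \<ge> max B 1" "residues_match m r h n" for n
        using V[rule_format, of n] that K by auto
      then show ?thesis by blast
    qed
    then obtain V B where V: "\<forall>n. \<bar>n\<bar> \<ge> B \<longrightarrow> residues_match m r h n \<longrightarrow>
        (pres_equiv {BS_rel m n} w [] \<longleftrightarrow> V)" by (elim exE) (rule that)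
    have "w \<in> BSbar m \<xi> \<longleftrightarrow> V"
      using w V match by (intro BSbar_iff[OF assms(1,3), of _ B h]) auto
    moreover have "w \<in> BSbar m \<xi>' \<longleftrightarrow> V"
      using w V match' rr by (intro BSbar_iff[OF assms(1,4), of _ B h]) auto
    ultimately show "w \<in> BSbar m \<xi> \<longleftrightarrow> w \<in> BSbar m \<xi>'" by simp
  qed
  ultimately show ?thesis by blast
qed

end
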